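(* For every finite simple triangle-free graph $G$, $\operatorname{elb}(G) \leq \operatorname{cc}(L(G))$.
   Context: All graphs are finite, simple, without loops. The line graph $L(G)$ of $G$ has vertex set $E(G)$, two vertices being adjacent iff the corresponding edges of $G$ share an endpoint. A chordal graph is a graph with no induced cycle of length more than three. The chordal covering number $\operatorname{cc}(H)$ of a graph $H$ is the minimum number of chordal graphs (on subsets of $V(H)$) whose union is $H$. An orientation of $G$ assigns a direction to each edge. Two adjacent edges $xy, xz$ of $G$ form an elbow in an orientation if both are directed towards $x$ or both are directed away from $x$. An elbow cover of $G$ is a family $\mathcal{O}$ of orientations of $G$ such that every pair of adjacent edges $xy, xz$ of $G$ forms an elbow in at least one orientation in $\mathcal{O}$; $\operatorname{elb}(G)$ is the minimum size of an elbow cover of $G$. *)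

theory Defs
  imports Main
begin

record 'a sgraph =
  verts :: "'a set"
  edges :: "'a set set"

definition simple_graph :: "'a sgraph \<Rightarrow> bool" where
  "simple_graph G \<longleftrightarrow> finite (verts G) \<and> (\<forall>e\<in>edges G. e \<subseteq> verts G \<and> card e = 2)"

definition triangle_free :: "'a sgraph \<Rightarrow> bool" where
  "triangle_free G \<longleftrightarrow>
     \<not> (\<exists>x y z. {x, y} \<in> edges G \<and> {y, z} \<in> edges G \<and> {x, z} \<in> edges G)"

definition line_graph :: "'a sgraph \<Rightarrow> 'a set sgraph" where
  "line_graph G = \<lparr> verts = edges G,
     edges = {{e, f} |e f. e \<in> edges G \<and> f \<in> edges G \<and> e \<noteq> f \<and> e \<inter> f \<noteq> {}} \<rparr>"

text \<open>The list gives the vertices of the cycle in cyclic order; being an equivalence, the last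
  conjunct asserts both that consecutive vertices are adjacent and that there are no chords.\<close>

definition induced_cycle :: "'a sgraph \<Rightarrow> 'a list \<Rightarrow> bool" where
  "induced_cycle G xs \<longleftrightarrow> length xs \<ge> 3 \<and> distinct xs \<and> set xs \<subseteq> verts G \<and>
     (\<forall>i<length xs. \<forall>j<length xs.
        {xs ! i, xs ! j} \<in> edges G \<longleftrightarrow>
          j = Suc i mod length xs \<or> i = Suc j mod length xs)"

definition chordal :: "'a sgraph \<Rightarrow> bool" where
  "chordal G \<longleftrightarrow> simple_graph G \<and> \<not> (\<exists>xs. induced_cycle G xs \<and> length xs > 3)"

definition graph_Union :: "'a sgraph set \<Rightarrow> 'a sgraph" where
  "graph_Union F = \<lparr> verts = (\<Union>C\<in>F. verts C), edges = (\<Union>C\<in>F. edges C) \<rparr>"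

text \<open>That the members live on subsets of the vertices of \<open>H\<close> is part of the equation for the
  union, which concerns vertices as well as edges.\<close>

definition chordal_cover :: "'a sgraph \<Rightarrow> 'a sgraph set \<Rightarrow> bool" where
  "chordal_cover H F \<longleftrightarrow> finite F \<and> (\<forall>C\<in>F. chordal C) \<and> graph_Union F = H"

definition cc :: "'a sgraph \<Rightarrow> nat" where
  "cc H = (LEAST k. \<exists>F. chordal_cover H F \<and> card F = k)"

text \<open>A pair \<open>(x, y)\<close> in an orientation means that the edge \<open>{x, y}\<close> is directed from \<open>x\<close>
  towards \<open>y\<close>.\<close>

definition orientation :: "'a sgraph \<Rightarrow> ('a \<times> 'a) set \<Rightarrow> bool" where
  "orientation G D \<longleftrightarrow>
     (\<forall>x y. (x, y) \<in> D \<longrightarrow> {x, y} \<in> edges G) \<and>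
     (\<forall>x y. {x, y} \<in> edges G \<longrightarrow> ((x, y) \<in> D \<longleftrightarrow> (y, x) \<notin> D))"

definition elbow :: "('a \<times> 'a) set \<Rightarrow> 'a \<Rightarrow> 'a \<Rightarrow> 'a \<Rightarrow> bool" where
  "elbow D x y z \<longleftrightarrow> (y, x) \<in> D \<and> (z, x) \<in> D \<or> (x, y) \<in> D \<and> (x, z) \<in> D"

definition elbow_cover :: "'a sgraph \<Rightarrow> ('a \<times> 'a) set set \<Rightarrow> bool" where
  "elbow_cover G \<O> \<longleftrightarrow> finite \<O> \<and> (\<forall>D\<in>\<O>. orientation G D) \<and>
     (\<forall>x y z. {x, y} \<in> edges G \<and> {x, z} \<in> edges G \<and> y \<noteq> z \<longrightarrow> (\<exists>D\<in>\<O>. elbow D x y z))"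

definition elb :: "'a sgraph \<Rightarrow> nat" where
  "elb G = (LEAST k. \<exists>\<O>. elbow_cover G \<O> \<and> card \<O> = k)"

text \<open>Both minima range over nonempty sets, so they are attained.\<close>

lemma chordal_small:
  assumes "simple_graph G" "card (verts G) \<le> 3"
  shows "chordal G"
proof -
  have "length xs \<le> 3" if "induced_cycle G xs" for xs
  proof -
    have "distinct xs" "set xs \<subseteq> verts G"
      using that by (auto simp: induced_cycle_def)
    moreover have "finite (verts G)"
      using assms(1) by (simp add: simple_graph_def)
    ultimately show ?thesis
      using assms(2) by (metis card_mono distinct_card order_trans)
  qed
  then show ?thesis
    using assms(1) by (force simp: chordal_def)
qed

lemma chordal_cover_exists:
  assumes "simple_graph H"
  shows "\<exists>F. chordal_cover H F"
proof -
  define F where "F = (\<lambda>v. \<lparr>verts = {v}, edges = {}\<rparr>) ` verts H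
    \<union> (\<lambda>e. \<lparr>verts = e, edges = {e}\<rparr>) ` edges H"
  have H: "finite (verts H)" "\<And>e. e \<in> edges H \<Longrightarrow> e \<subseteq> verts H \<and> card e = 2"
    using assms by (auto simp: simple_graph_def)
  then have "finite (edges H)"
    by (meson PowI finite_Pow_iff finite_subset subsetI)
  with H have "finite F"
    by (simp add: F_def)
  moreover have "chordal C" if "C \<in> F" for C
  proof -
    have "simple_graph C \<and> card (verts C) \<le> 3"
      using that H by (auto simp: F_def simple_graph_def intro: card_ge_0_finite)
    then show ?thesis
      by (blast intro: chordal_small)
  qed
  moreover have "graph_Union F = H"
  proof -
    have "(\<Union>C\<in>F. verts C) = verts H" "(\<Union>C\<in>F. edges C) = edges H"
      using H(2) by (auto simp: F_def)
    then show ?thesis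
      by (simp add: graph_Union_def)
  qed
  ultimately show ?thesis
    unfolding chordal_cover_def by blast
qed

lemma elbow_cover_exists:
  assumes "simple_graph G"
  shows "\<exists>\<O>. elbow_cover G \<O>"
proof -
  have G: "finite (verts G)" "\<And>e. e \<in> edges G \<Longrightarrow> e \<subseteq> verts G \<and> card e = 2"
    using assms by (auto simp: simple_graph_def)
  have E: "x \<in> verts G \<and> y \<in> verts G \<and> x \<noteq> y" if "{x, y} \<in> edges G" for x y
    using G(2)[OF that] by (auto split: if_splits simp: card_insert_if)
  obtain f :: "'a \<Rightarrow> nat" where f: "inj_on f (verts G)"
    using finite_imp_inj_to_nat_seg[OF G(1)] by auto
  define g where "g v u = (if u = v then 0 else Suc (f u))" for u v
  define D where "D v = {(x, y). {x, y} \<in> edges G \<and> g v x < g v y}" for v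
  have "orientation G (D v)" for v
    unfolding orientation_def
  proof (intro conjI allI impI)
    fix x y
    show "{x, y} \<in> edges G" if "(x, y) \<in> D v"
      using that by (simp add: D_def)
    assume xy: "{x, y} \<in> edges G"
    then have "f x \<noteq> f y"
      using E[OF xy] f by (auto dest: inj_onD)
    then have "g v x \<noteq> g v y"
      using E[OF xy] by (auto simp: g_def)
    then show "(x, y) \<in> D v \<longleftrightarrow> (y, x) \<notin> D v"
      using xy by (auto simp: D_def insert_commute)
  qed
  moreover have "elbow (D x) x y z" if "{x, y} \<in> edges G" "{x, z} \<in> edges G" for x y z
    using that E[OF that(1)] E[OF that(2)] by (auto simp: elbow_def D_def g_def)
  ultimately have "elbow_cover G (D ` verts G)"
    using G(1) E unfolding elbow_cover_def by blast
  then show ?thesis ..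
qed

lemma cc_attained:
  assumes "simple_graph H"
  shows "\<exists>F. chordal_cover H F \<and> card F = cc H"
proof -
  have "\<exists>k F. chordal_cover H F \<and> card F = k"
    using chordal_cover_exists[OF assms] by blast
  then show ?thesis
    unfolding cc_def by (rule LeastI_ex)
qed

lemma elb_attained:
  assumes "simple_graph G"
  shows "\<exists>\<O>. elbow_cover G \<O> \<and> card \<O> = elb G"
proof -
  have "\<exists>k \<O>. elbow_cover G \<O> \<and> card \<O> = k"
    using elbow_cover_exists[OF assms] by blast
  then show ?thesis
    unfolding elb_def by (rule LeastI_ex)
qed

lemma simple_graph_line_graph:
  assumes "simple_graph G"
  shows "simple_graph (line_graph G)"
proof -
  have "finite (edges G)"
    using assms unfolding simple_graph_def
    by (meson PowI finite_Pow_iff finite_subset subsetI)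
  then show ?thesis
    by (auto simp: simple_graph_def line_graph_def card_insert_if)
qed

end

theory Submission
  imports Defs
begin

text \<open>A chordal subgraph \<open>C\<close> of the line graph of a triangle-free graph \<open>G\<close> gives one
  orientation of \<open>G\<close> in which every edge of \<open>C\<close> is an elbow; applying this to each member of a
  chordal cover yields an elbow cover. To find the orientation, link two arcs with the same tail
  or the same head when their underlying edges are adjacent in \<open>C\<close>. An orientation that is a
  union of components of this relation works, and it exists unless some arc is connected to its
  reversal. Suppose one is, and take a shortest such walk. Its underlying edges form a cycle in
  \<open>C\<close>, and a chord of the cycle would give a shorter walk of the same kind, so the cycle is
  induced and hence a triangle. As \<open>G\<close> is triangle-free, the three edges share a vertex, and
  then the walk cannot turn an arc around.\<close>

section \<open>Arcs and links\<close>

definition und :: "'a \<times> 'a \<Rightarrow> 'a set" where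
  "und a = {fst a, snd a}"

text \<open>An elbow at the common endpoint means exactly that linked arcs are both chosen or both
  rejected. Treating tails and heads alike makes reversal a symmetry of the relation.\<close>

definition link :: "'a set sgraph \<Rightarrow> (('a \<times> 'a) \<times> ('a \<times> 'a)) set" where
  "link C = {(a, b). {und a, und b} \<in> edges C \<and> (fst a = fst b \<or> snd a = snd b)}"

lemma und_swap [simp]: "und (prod.swap a) = und a"
  by (auto simp: und_def)

lemma und_eq_iff: "und a = und b \<longleftrightarrow> a = b \<or> a = prod.swap b"
  by (cases a; cases b) (auto simp: und_def doubleton_eq_iff)

lemma link_sym: "(a, b) \<in> link C \<Longrightarrow> (b, a) \<in> link C"
  by (auto simp: link_def insert_commute)

lemma link_swap: "(a, b) \<in> link C \<Longrightarrow> (prod.swap a, prod.swap b) \<in> link C"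
  by (auto simp: link_def)

lemma link_rtrancl_swap:
  "(a, b) \<in> (link C)\<^sup>* \<Longrightarrow> (prod.swap a, prod.swap b) \<in> (link C)\<^sup>*"
  by (induction rule: rtrancl_induct) (auto dest: link_swap intro: rtrancl_into_rtrancl)

lemma link_rtrancl_sym: "(a, b) \<in> (link C)\<^sup>* \<Longrightarrow> (b, a) \<in> (link C)\<^sup>*"
  by (metis link_sym sym_def sym_rtrancl)

lemma relpow_segment:
  assumes "\<And>k. k < n \<Longrightarrow> (w k, w (Suc k)) \<in> R" "i \<le> j" "j \<le> n"
  shows "(w i, w j) \<in> R ^^ (j - i)"
  unfolding relpow_fun_conv
  by (rule exI[of _ "\<lambda>k. w (i + k)"]) (use assms in auto)

section \<open>Walks in a chordal subgraph of the line graph\<close>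

context
  fixes G :: "'a sgraph" and C :: "'a set sgraph"
  assumes G: "simple_graph G" "triangle_free G"
    and C: "chordal C" "edges C \<subseteq> edges (line_graph G)"
begin

lemma edge_neq: "{x, y} \<in> edges G \<Longrightarrow> x \<noteq> y"
  using G(1) by (auto simp: simple_graph_def)

lemma chordal_edgeD:
  assumes "{e, f} \<in> edges C"
  shows "e \<in> verts C" "e \<in> edges G" "f \<in> edges G" "e \<noteq> f" "e \<inter> f \<noteq> {}"
proof -
  show "e \<in> verts C"
    using assms C(1) by (auto simp: chordal_def simple_graph_def)
  have "{e, f} \<in> edges (line_graph G)"
    using assms C(2) by blast
  then show "e \<in> edges G" "f \<in> edges G" "e \<noteq> f" "e \<inter> f \<noteq> {}"
    by (auto simp: line_graph_def doubleton_eq_iff)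
qed

lemma linkD:
  assumes "(a, b) \<in> link C"
  shows "{und a, und b} \<in> edges C" "fst a \<noteq> snd a" "fst b \<noteq> snd b"
    "{fst a, snd a} \<in> edges G" "{fst b, snd b} \<in> edges G"
proof -
  show e: "{und a, und b} \<in> edges C"
    using assms by (simp add: link_def)
  show "{fst a, snd a} \<in> edges G" "{fst b, snd b} \<in> edges G"
    using chordal_edgeD(2,3)[OF e] by (simp_all add: und_def)
  then show "fst a \<noteq> snd a" "fst b \<noteq> snd b"
    by (auto dest: edge_neq)
qed

text \<open>The two edges share an endpoint, and reversing \<open>b\<close> if necessary gives it
  the same role in both arcs. This turns a chord of the cycle into a link.\<close>

lemma link_cases:
  assumes "{und a, und b} \<in> edges C"
  shows "(a, b) \<in> link C \<or> (a, prod.swap b) \<in> link C"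
proof -
  have "und a \<inter> und b \<noteq> {}"
    using chordal_edgeD(5)[OF assms] .
  then show ?thesis
    using assms by (auto simp: link_def und_def insert_commute)
qed

text \<open>Each of the four combinations of shared tails and heads would make \<open>a\<close> or
  \<open>b\<close> a loop.\<close>

lemma no_reversing_walk_2:
  assumes "(a, b) \<in> link C" "(b, prod.swap a) \<in> link C"
  shows False
  using assms linkD(2,3)[OF assms(1)] by (auto simp: link_def)

text \<open>If the shared ends alternate between tails and heads along the walk, the three edges
  form a triangle of \<open>G\<close>. In the six other cases some arc is a loop.\<close>

lemma no_reversing_walk_3:
  assumes "(a, b) \<in> link C" "(b, c) \<in> link C" "(c, prod.swap a) \<in> link C"
  shows False
proof -
  define E where "E x y \<longleftrightarrow> {x, y} \<in> edges G" for x y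
  have sym: "E x y \<Longrightarrow> E y x" for x y
    by (simp add: E_def insert_commute)
  have irrefl: "\<not> E x x" for x
    using edge_neq[of x x] by (auto simp: E_def)
  have no_triangle: "\<not> (E x y \<and> E y z \<and> E x z)" for x y z
    using G(2) unfolding triangle_free_def E_def by blast
  obtain p q r s t u where [simp]: "a = (p, q)" "b = (r, s)" "c = (t, u)"
    by (metis surj_pair)
  have "E p q" "E r s" "E t u"
    using linkD(4)[OF assms(1)] linkD(4,5)[OF assms(2)] by (simp_all add: E_def)
  moreover have "p = r \<or> q = s" "r = t \<or> s = u" "t = q \<or> u = p"
    using assms by (auto simp: link_def)
  ultimately show False
    using sym irrefl no_triangle by blast
qed

text \<open>Strong induction on the length, for all arcs at once, since the shorter walk obtained
  from a chord may reverse an arc other than \<open>a\<close>.\<close>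

lemma no_reversing_walk:
  assumes "fst a \<noteq> snd a"
  shows "(a, prod.swap a) \<notin> (link C) ^^ n"
  using assms
proof (induction n arbitrary: a rule: less_induct)
  case (less n)
  let ?R = "link C"
  show ?case
  proof
    assume "(a, prod.swap a) \<in> ?R ^^ n"
    then obtain w where w0: "w 0 = a" and wn: "w n = prod.swap a"
      and step: "\<And>k. k < n \<Longrightarrow> (w k, w (Suc k)) \<in> ?R"
      by (auto simp: relpow_fun_conv)
    note seg = relpow_segment[of n w, OF step]
    have neq: "fst (w i) \<noteq> snd (w i)" if "i < n" for i
      using linkD(2)[OF step[OF that]] .
    \<comment> \<open>Splicing a shorter piece between \<open>w i\<close> and \<open>w j\<close>
      into the walk would reverse \<open>a\<close> in fewer than \<open>n\<close> steps.\<close>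
    have no_shortcut: "(w i, w j) \<notin> ?R ^^ m" if "i \<le> j" "j \<le> n" "m < j - i" for i j m
    proof
      assume "(w i, w j) \<in> ?R ^^ m"
      then have "(w 0, w n) \<in> ?R ^^ (i + m + (n - j))"
        using relpow_trans[OF relpow_trans[OF seg[of 0 i]] seg[of j n]] that by simp
      then show False
        using less.IH[of "i + m + (n - j)" a] less.prems that w0 wn by (simp, linarith)
    qed
    \<comment> \<open>A link from \<open>w i\<close> to \<open>w j\<close> is a shortcut unless
      \<open>j = Suc i\<close>. A link to the reversal of \<open>w j\<close> closes up the segment
      to a walk that reverses \<open>w i\<close> in \<open>Suc (j - i)\<close> steps; this is less
      than \<open>n\<close> except for the closing edge of the cycle.\<close>
    have chord: "j = Suc i \<or> i = 0 \<and> Suc j = n"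
      if e: "{und (w i), und (w j)} \<in> edges C" and ij: "i < j" "j < n" for i j
    proof -
      consider "(w i, w j) \<in> ?R" | "(w i, prod.swap (w j)) \<in> ?R"
        using link_cases[OF e] by blast
      then show ?thesis
      proof cases
        case 1
        then have "(w i, w j) \<in> ?R ^^ 1"
          by simp
        then show ?thesis
          using no_shortcut[of i j 1] ij by force
      next
        case 2
        then have "(w j, prod.swap (w i)) \<in> ?R"
          using link_swap link_sym by fastforce
        then have "(w i, prod.swap (w i)) \<in> ?R ^^ Suc (j - i)"
          using seg[of i j] ij by auto
        then show ?thesis
          using less.IH[of "Suc (j - i)" "w i"] neq[of i] ij by force
      qed
    qed
    have distinct: "und (w i) \<noteq> und (w j)" if ij: "i < j" "j < n" for i j
    proof
      assume "und (w i) = und (w j)"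
      then consider "w i = w j" | "w j = prod.swap (w i)"
        by (metis und_eq_iff)
      then show False
      proof cases
        case 1
        then show False
          using no_shortcut[of i j 0] ij by simp
      next
        case 2
        then show False
          using seg[of i j] less.IH[of "j - i" "w i"] neq[of i] ij by simp
      qed
    qed
    \<comment> \<open>Chordality excludes only cycles of length above three, so shorter walks are
      ruled out separately; triangle-freeness enters at length 3.\<close>
    have "n \<noteq> 0"
    proof
      assume "n = 0"
      then have "a = prod.swap a"
        using w0 wn by simp
      then show False
        using less.prems by (metis fst_swap)
    qed
    moreover have "n \<noteq> 1"
    proof
      assume "n = 1"
      then have "(a, prod.swap a) \<in> ?R"
        using step[of 0] w0 wn by simp
      then show False
        using less.prems by (auto simp: link_def)
    qed
    moreover have "n \<noteq> 2"
    proof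
      assume "n = 2"
      then show False
        using step[of 0] step[of 1] w0 wn no_reversing_walk_2[of a "w 1"]
        by (simp add: numeral_2_eq_2)
    qed
    moreover have "n \<noteq> 3"
    proof
      assume "n = 3"
      then show False
        using step[of 0] step[of 1] step[of 2] w0 wn no_reversing_walk_3[of a "w 1" "w 2"]
        by (simp add: numeral_eq_Suc)
    qed
    ultimately have n: "n > 3"
      by linarith
    \<comment> \<open>The arcs \<open>w 0\<close> and \<open>w n\<close> are opposite but have the
      same underlying edge, so the sequence of edges closes up.\<close>
    have cyc: "{und (w i), und (w (Suc i mod n))} \<in> edges C" if "i < n" for i
    proof (cases "Suc i = n")
      case True
      then show ?thesis
        using linkD(1)[OF step[OF that]] w0 wn by simp
    next
      case False
      then show ?thesis
        using linkD(1)[OF step[OF that]] that by simp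
    qed
    have chord_mod: "j = Suc i mod n \<or> i = Suc j mod n"
      if "{und (w i), und (w j)} \<in> edges C" "i < n" "j < n" for i j
      using that
    proof (induction i j rule: linorder_wlog)
      case (le i j)
      then have "i \<noteq> j"
        using chordal_edgeD(4) by blast
      then show ?case
        using chord[of i j] le by fastforce
    next
      case (sym i j)
      then show ?case
        by (auto simp: insert_commute)
    qed
    let ?xs = "map (\<lambda>i. und (w i)) [0..<n]"
    have "induced_cycle C ?xs"
      unfolding induced_cycle_def
    proof (intro conjI allI impI)
      show "length ?xs \<ge> 3"
        using n by simp
      show "distinct ?xs"
        using distinct by (auto simp: distinct_map inj_on_def) (metis linorder_neqE_nat)
      show "set ?xs \<subseteq> verts C"
        using chordal_edgeD(1)[OF cyc] by auto
      fix i j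
      assume "i < length ?xs" "j < length ?xs"
      then show "{?xs ! i, ?xs ! j} \<in> edges C \<longleftrightarrow>
          j = Suc i mod length ?xs \<or> i = Suc j mod length ?xs"
        using chord_mod[of i j] cyc[of i] cyc[of j] by (auto simp: insert_commute)
    qed
    then show False
      using C(1) n unfolding chordal_def by fastforce
  qed
qed

section \<open>An orientation made of components\<close>

lemma exists_orientation:
  "\<exists>D. orientation G D \<and> (\<forall>x y z. {{x, y}, {x, z}} \<in> edges C \<longrightarrow> elbow D x y z)"
proof -
  define comp where "comp a = (link C)\<^sup>* `` {a}" for a
  \<comment> \<open>The two components of an edge form an unordered pair, so the choice made by \<open>SOME\<close>
    is the same for an arc and its reversal.\<close>
  define D where "D = {a. und a \<in> edges G \<and>
    (SOME K. K \<in> {comp a, comp (prod.swap a)}) = comp a}"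
  have comp_eq: "comp a = comp b" if "(a, b) \<in> (link C)\<^sup>*" for a b
    using that by (auto simp: comp_def intro: rtrancl_trans dest: link_rtrancl_sym)
  have comp_neq: "comp a \<noteq> comp (prod.swap a)" if "fst a \<noteq> snd a" for a
  proof
    assume "comp a = comp (prod.swap a)"
    then have "(a, prod.swap a) \<in> (link C)\<^sup>*"
      by (auto simp: comp_def)
    then show False
      using no_reversing_walk[OF that] rtrancl_imp_relpow by blast
  qed
  have D_link: "a \<in> D \<longleftrightarrow> b \<in> D" if "(a, b) \<in> link C" for a b
  proof -
    have "comp a = comp b" "comp (prod.swap a) = comp (prod.swap b)"
      using that link_swap[OF that] by (auto intro!: comp_eq)
    then show ?thesis
      using linkD(4,5)[OF that] by (simp add: D_def und_def)
  qed
  have D_swap: "a \<in> D \<longleftrightarrow> prod.swap a \<notin> D" if "und a \<in> edges G" for a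
  proof -
    have "fst a \<noteq> snd a"
      using that by (auto simp: und_def dest: edge_neq)
    then have neq: "comp a \<noteq> comp (prod.swap a)"
      by (rule comp_neq)
    define S where "S = (SOME K. K \<in> {comp a, comp (prod.swap a)})"
    have "S \<in> {comp a, comp (prod.swap a)}"
      unfolding S_def by (rule someI[of _ "comp a"]) simp
    moreover have "a \<in> D \<longleftrightarrow> S = comp a"
      using that unfolding D_def S_def by blast
    moreover have "prod.swap a \<in> D \<longleftrightarrow> S = comp (prod.swap a)"
      using that unfolding D_def S_def mem_Collect_eq und_swap swap_swap
      by (subst insert_commute) blast
    ultimately show ?thesis
      using neq by blast
  qed
  have "orientation G D"
    unfolding orientation_def
  proof (intro conjI allI impI)
    fix x y
    show "{x, y} \<in> edges G" if "(x, y) \<in> D"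
      using that by (simp add: D_def und_def)
    show "(x, y) \<in> D \<longleftrightarrow> (y, x) \<notin> D" if "{x, y} \<in> edges G"
      using D_swap[of "(x, y)"] that by (simp add: und_def)
  qed
  moreover have "elbow D x y z" if e: "{{x, y}, {x, z}} \<in> edges C" for x y z
  proof -
    \<comment> \<open>Either both arcs leaving \<open>x\<close> lie in \<open>D\<close>, or neither
      does and both reversals do.\<close>
    have "((x, y), (x, z)) \<in> link C"
      using e by (simp add: link_def und_def)
    moreover from link_swap[OF this] have "((y, x), (z, x)) \<in> link C"
      by simp
    moreover have "{x, y} \<in> edges G"
      using chordal_edgeD(2)[OF e] .
    ultimately show ?thesis
      using D_link D_swap[of "(x, y)"] unfolding elbow_def und_def by auto
  qed
  ultimately show ?thesis
    by blast
qed

end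

section \<open>Assembling the elbow cover\<close>

theorem theorem4:
  fixes G :: "'a sgraph"
  assumes "simple_graph G" and "triangle_free G"
  shows "elb G \<le> cc (line_graph G)"
proof -
  let ?L = "line_graph G"
  obtain F where F: "chordal_cover ?L F" "card F = cc ?L"
    using cc_attained[OF simple_graph_line_graph[OF assms(1)]] by blast
  have fin: "finite F" and chordal: "\<And>C. C \<in> F \<Longrightarrow> chordal C"
    and union: "graph_Union F = ?L"
    using F(1) by (auto simp: chordal_cover_def)
  have edges: "edges ?L = (\<Union>C\<in>F. edges C)"
    by (subst union[symmetric]) (simp add: graph_Union_def)
  have "\<exists>D. orientation G D \<and> (\<forall>x y z. {{x, y}, {x, z}} \<in> edges C \<longrightarrow> elbow D x y z)"
    if "C \<in> F" for C
  proof (rule exists_orientation[OF assms chordal[OF that]])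
    show "edges C \<subseteq> edges ?L"
      unfolding edges using that by blast
  qed
  then have "\<exists>D. \<forall>C\<in>F. orientation G (D C) \<and>
      (\<forall>x y z. {{x, y}, {x, z}} \<in> edges C \<longrightarrow> elbow (D C) x y z)"
    by (intro bchoice ballI)
  then obtain D where D: "\<forall>C\<in>F. orientation G (D C) \<and>
      (\<forall>x y z. {{x, y}, {x, z}} \<in> edges C \<longrightarrow> elbow (D C) x y z)"
    by (rule exE)
  have "elbow_cover G (D ` F)"
    unfolding elbow_cover_def
  proof (intro conjI allI impI)
    fix x y z
    assume xyz: "{x, y} \<in> edges G \<and> {x, z} \<in> edges G \<and> y \<noteq> z"
    then have "{x, y} \<noteq> {x, z}" "{x, y} \<inter> {x, z} \<noteq> {}"
      by (auto simp: doubleton_eq_iff)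
    then have "{{x, y}, {x, z}} \<in> edges ?L"
      unfolding line_graph_def sgraph.select_convs mem_Collect_eq using xyz
      by (intro exI[of _ "{x, y}"] exI[of _ "{x, z}"]) simp
    then obtain C where "C \<in> F" "{{x, y}, {x, z}} \<in> edges C"
      unfolding edges by blast
    then show "\<exists>D\<in>D ` F. elbow D x y z"
      using D by blast
  qed (use fin D in auto)
  then have "elb G \<le> card (D ` F)"
    unfolding elb_def by (intro Least_le) blast
  \<comment> \<open>Different members of \<open>F\<close> may yield the same orientation, hence only
    an inequality.\<close>
  also have "\<dots> \<le> cc ?L"
    unfolding F(2)[symmetric] by (rule card_image_le[OF fin])
  finally show ?thesis .
qed

end
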